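(* Let $M\in\mathbb{R}^{p\times q}$ be nonzero and have rank $r$, with positive singular values $\sigma_1\geq\sigma_2\geq\cdots\geq\sigma_r>0$ and thin SVD $M=U_r\Sigma_rV_r^T$, $\Sigma_r=\operatorname{diag}(\sigma_1,\dots,\sigma_r)$. Let $\alpha\in\mathbb{R}$ and let $\{X_k\}_{k\ge 0}\subset\mathbb{R}^{q\times p}$ be generated by $$X_0=\alpha M^T,\qquad X_{k+1}=X_k(2I_p-MX_k)=2X_k-X_kMX_k .$$ If $$0<\alpha<\frac{2}{\sigma_1^2},$$ then $X_k\to M^\dagger$. More precisely, with $\theta_i:=1-\alpha\sigma_i^2$ for $i=1,\dots,r$, for every $k\ge 0$ $$X_k=V_r\operatorname{diag}\!\left(\frac{1-\theta_1^{2^k}}{\sigma_1},\frac{1-\theta_2^{2^k}}{\sigma_2},\ldots,\frac{1-\theta_r^{2^k}}{\sigma_r}\right)U_r^T .$$ In particular, with $P_L:=MM^\dagger=U_rU_r^T$ and $P_R:=M^\dagger M=V_rV_r^T$, one has $$P_L-MX_k=U_r\operatorname{diag}(\theta_1^{2^k},\ldots,\theta_r^{2^k})U_r^T,\qquad P_R-X_kM=V_r\operatorname{diag}(\theta_1^{2^k},\ldots,\theta_r^{2^k})V_r^T .$$ Hence, if $\rho_0:=\max_{1\leq i\leq r}|1-\alpha\sigma_i^2|<1$, then $$\|P_L-MX_k\|_2=\|P_R-X_kM\|_2=\rho_0^{2^k}.$$ For the zero matrix $M=0$, $M^\dagger=0$ and the initialization $X_0=\alpha M^T$ gives $X_k=0$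 for all $k$.
   Context: $M^\dagger\in\mathbb{R}^{q\times p}$ is the usual Moore--Penrose inverse of a real matrix $M\in\mathbb{R}^{p\times q}$; $\|\cdot\|_2$ is the spectral norm. A thin SVD means $U_r\in\mathbb{R}^{p\times r}$ and $V_r\in\mathbb{R}^{q\times r}$ have orthonormal columns. *)

theory Defs
  imports "HOL-Analysis.Analysis"
begin

text \<open>
  A real matrix with rows indexed by \<open>'p\<close> and columns indexed by \<open>'q\<close> has type
  \<open>real^'q^'p\<close>.
\<close>

definition is_moore_penrose :: "real^'q^'p \<Rightarrow> real^'p^'q \<Rightarrow> bool" where
  "is_moore_penrose M Y \<longleftrightarrow>
     M ** Y ** M = M \<and> Y ** M ** Y = Y \<and>
     transpose (M ** Y) = M ** Y \<and> transpose (Y ** M) = Y ** M"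

definition pinv :: "real^'q^'p \<Rightarrow> real^'p^'q" where
  "pinv M = (THE Y. is_moore_penrose M Y)"

lemma is_moore_penrose_unique:
  assumes Y: "is_moore_penrose M Y" and Z: "is_moore_penrose M Z"
  shows "Y = Z"
proof -
  note pY = Y[unfolded is_moore_penrose_def] and pZ = Z[unfolded is_moore_penrose_def]
  have "M ** Y = (M ** Z) ** (M ** Y)"
    using pZ by (simp add: matrix_mul_assoc)
  also have "\<dots> = transpose (M ** Y ** (M ** Z))"
    using pY pZ by (simp add: matrix_transpose_mul)
  also have "\<dots> = M ** Z"
    using pY pZ by (simp add: matrix_mul_assoc)
  finally have L: "M ** Y = M ** Z" .
  have "Y ** M = (Y ** M) ** (Z ** M)"
    using pZ by (metis matrix_mul_assoc)
  also have "\<dots> = transpose (Z ** M ** (Y ** M))"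
    using pY pZ by (simp add: matrix_transpose_mul)
  also have "\<dots> = Z ** M"
    using pY pZ by (metis matrix_mul_assoc)
  finally have R: "Y ** M = Z ** M" .
  show "Y = Z"
    using pY pZ L R by (metis matrix_mul_assoc)
qed

text \<open>The operator norm induced by the Euclidean norms on both sides.\<close>

definition spectral_norm :: "real^'q^'p \<Rightarrow> real" where
  "spectral_norm A = onorm (\<lambda>x. A *v x)"

definition diag :: "('r \<Rightarrow> real) \<Rightarrow> real^'r^'r" where
  "diag d = (\<chi> i j. if i = j then d i else 0)"

definition orthonormal_columns :: "real^'r^'p \<Rightarrow> bool" where
  "orthonormal_columns U \<longleftrightarrow>
     (\<forall>i j. inner (column i U) (column j U) = (if i = j then 1 else 0))"

text \<open>
  The linearly ordered finite type \<open>'r\<close> plays the role of \<open>{1, \<dots>, r}\<close> with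
  \<open>r = CARD('r)\<close>, so \<open>\<sigma>\<^sub>1\<close> is \<open>\<sigma> (Min UNIV)\<close>.  Orthonormality of the columns of
  \<open>U\<close> and \<open>V\<close> forces the \<open>\<sigma> i\<close> to be exactly the positive singular values of \<open>M\<close>, with
  multiplicity.
\<close>

definition thin_svd ::
    "real^'q^'p \<Rightarrow> real^('r::{finite,linorder})^'p \<Rightarrow> ('r::{finite,linorder} \<Rightarrow> real) \<Rightarrow>
       real^('r::{finite,linorder})^'q \<Rightarrow> bool" where
  "thin_svd M U \<sigma> V \<longleftrightarrow>
     orthonormal_columns U \<and> orthonormal_columns V \<and>
     (\<forall>i. \<sigma> i > 0) \<and> (\<forall>i j. i \<le> j \<longrightarrow> \<sigma> j \<le> \<sigma> i) \<and>
     M = U ** diag \<sigma> ** transpose V"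

end

theory Submission
  imports Defs
begin

text \<open>
  Matrices of the form \<open>V ** diag d ** transpose U\<close>, with \<open>U\<close> and \<open>V\<close> having orthonormal
  columns, add and multiply through their diagonals \<open>d\<close>.  On the diagonal the recursion reads
  \<open>x \<mapsto> 2 * x - \<sigma> * x\<^sup>2\<close>, which squares the residual \<open>1 - \<sigma> * x\<close>; the latter starts at
  \<open>1 - \<alpha> * \<sigma>\<^sup>2\<close>.
\<close>

section \<open>Algebra of diagonal matrices and of products
  \<open>V ** diag d ** transpose U\<close>\<close>

lemma diag_mult: "diag a ** diag b = diag (\<lambda>i. a i * b i)"
  by (simp add: diag_def matrix_matrix_mult_def vec_eq_iff if_distribR
      if_distrib[of "\<lambda>y. y * _"] cong: if_cong)

lemma diag_diff: "diag a - diag b = diag (\<lambda>i. a i - b i)"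
  by (simp add: diag_def vec_eq_iff)

lemma diag_scaleR: "c *\<^sub>R diag a = diag (\<lambda>i. c * a i)"
  by (simp add: diag_def vec_eq_iff)

lemma transpose_diag: "transpose (diag a) = diag a"
  unfolding diag_def transpose_def vec_eq_iff by auto

lemma diag_one: "diag (\<lambda>_. 1) = mat 1"
  by (simp add: diag_def mat_def)

lemma diag_mult_vec_component: "(diag d *v x) $ i = d i * x $ i"
  by (simp add: diag_def matrix_vector_mult_def if_distribR if_distrib[of "\<lambda>y. y * _"]
      cong: if_cong)

lemma orthonormal_columns_transpose_mult:
  "orthonormal_columns U \<Longrightarrow> transpose U ** U = mat 1"
  by (simp add: orthonormal_columns_def matrix_matrix_mult_def transpose_def mat_def
      vec_eq_iff inner_vec_def column_def)

text \<open>Orthonormality turns the middle factor \<open>transpose U ** U\<close> into the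
  identity, so the two diagonals become adjacent and multiply pointwise.\<close>

lemma sandwich_mult:
  assumes "orthonormal_columns U"
  shows "(V ** diag a ** transpose U) ** (U ** diag b ** transpose W)
    = V ** diag (\<lambda>i. a i * b i) ** transpose W"
proof -
  have "(V ** diag a ** transpose U) ** (U ** diag b ** transpose W)
    = V ** diag a ** (transpose U ** U) ** diag b ** transpose W"
    by (simp add: matrix_mul_assoc)
  also have "\<dots> = V ** (diag a ** diag b) ** transpose W"
    by (simp add: orthonormal_columns_transpose_mult[OF assms] matrix_mul_assoc)
  finally show ?thesis by (simp add: diag_mult)
qed

lemma matrix_diff_ldistrib:
  fixes A :: "real^'m^'n"
  shows "A ** (B - C) = A ** B - A ** C"
  by (simp add: matrix_matrix_mult_def vec_eq_iff right_diff_distrib sum_subtractf)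

lemma matrix_diff_rdistrib:
  fixes A :: "real^'m^'n"
  shows "(A - B) ** C = A ** C - B ** C"
  by (simp add: matrix_matrix_mult_def vec_eq_iff left_diff_distrib sum_subtractf)

lemma sandwich_diff:
  "V ** diag a ** transpose U - V ** diag b ** transpose U
    = V ** diag (\<lambda>i. a i - b i) ** transpose U"
  by (simp add: matrix_diff_ldistrib matrix_diff_rdistrib flip: diag_diff)

lemma sandwich_scaleR:
  "c *\<^sub>R (V ** diag a ** transpose U) = V ** diag (\<lambda>i. c * a i) ** transpose U"
  by (simp add: matrix_scalar_ac flip: diag_scaleR scalar_matrix_assoc)

lemma transpose_sandwich:
  "transpose (V ** diag a ** transpose U) = U ** diag a ** transpose V"
  by (simp add: matrix_transpose_mul transpose_diag matrix_mul_assoc)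

lemma sandwich_one: "V ** diag (\<lambda>_. 1) ** transpose U = V ** transpose U"
  by (simp add: diag_one)

text \<open>Matrix convergence is entrywise, and each entry is a finite sum that is linear in the
  values \<open>d k l\<close>, so limits of the diagonals carry over.\<close>

lemma tendsto_sandwich_diag:
  assumes "\<And>i. ((\<lambda>k. d k i) \<longlongrightarrow> e i) F"
  shows "((\<lambda>k. V ** diag (d k) ** transpose U) \<longlongrightarrow> V ** diag e ** transpose U) F"
proof (intro vec_tendstoI)
  fix i j
  have "(V ** diag a ** transpose U) $ i $ j = (\<Sum>l\<in>UNIV. V $ i $ l * a l * U $ j $ l)" for a
    by (simp add: matrix_matrix_mult_def diag_def transpose_def if_distrib[of "\<lambda>y. _ * y"]
        cong: if_cong)
  then show "((\<lambda>k. (V ** diag (d k) ** transpose U) $ i $ j)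
    \<longlongrightarrow> (V ** diag e ** transpose U) $ i $ j) F"
    by (simp only:) (intro tendsto_intros assms)
qed

section \<open>The Moore-Penrose inverse read off from a thin SVD\<close>

lemma pinv_unique: "is_moore_penrose M Y \<Longrightarrow> pinv M = Y"
  unfolding pinv_def by (rule the_equality, assumption, rule is_moore_penrose_unique)

lemma pinv_zero: "pinv 0 = 0"
  by (rule pinv_unique) (simp add: is_moore_penrose_def transpose_def vec_eq_iff)

text \<open>The products with the candidate, in either order, have all diagonal values
  \<open>\<sigma> i * (1 / \<sigma> i) = 1\<close>. Hence they are symmetric and leave both matrices
  fixed, which gives the four Penrose equations.\<close>

lemma pinv_sandwich:
  assumes "orthonormal_columns U" "orthonormal_columns V" "\<And>i. \<sigma> i \<noteq> 0"
  shows "pinv (U ** diag \<sigma> ** transpose V) = V ** diag (\<lambda>i. 1 / \<sigma> i) ** transpose U"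
  by (rule pinv_unique)
    (simp add: is_moore_penrose_def sandwich_mult transpose_sandwich assms)

section \<open>Norm estimates and the spectral norm\<close>

lemma norm_orthonormal_columns_mult:
  assumes "orthonormal_columns U"
  shows "norm (U *v x) = norm x"
proof -
  have "(U *v x) \<bullet> (U *v x) = (transpose U *v (U *v x)) \<bullet> x"
    by (simp only: dot_lmul_matrix transpose_matrix_vector)
  also have "\<dots> = ((transpose U ** U) *v x) \<bullet> x"
    by (simp only: matrix_vector_mul_assoc)
  finally show ?thesis
    by (simp add: orthonormal_columns_transpose_mult[OF assms] norm_eq_sqrt_inner)
qed

text \<open>Moving \<open>U\<close> across the inner product and applying Cauchy-Schwarz bounds the
  square of the left-hand norm by \<open>norm x\<close> times that norm, because \<open>U\<close> is
  an isometry. One factor then cancels.\<close>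

lemma norm_transpose_orthonormal_columns_mult_le:
  assumes "orthonormal_columns U"
  shows "norm (transpose U *v x) \<le> norm x"
proof -
  let ?y = "transpose U *v x"
  have "norm ?y * norm ?y = ?y \<bullet> ?y"
    by (simp only: dot_square_norm power2_eq_square)
  also have "\<dots> = x \<bullet> (U *v ?y)"
    by (simp only: dot_lmul_matrix transpose_matrix_vector)
  also have "\<dots> \<le> norm x * norm ?y"
    using norm_cauchy_schwarz[of x "U *v ?y"] norm_orthonormal_columns_mult[OF assms] by simp
  finally show ?thesis
    by (cases "norm ?y = 0") auto
qed

lemma norm_diag_mult_le:
  assumes "\<And>i. \<bar>d i\<bar> \<le> c"
  shows "norm (diag d *v x) \<le> c * norm x"
proof -
  have "norm (diag d *v x) \<le> norm (c *\<^sub>R x)"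
    by (rule norm_le_componentwise_cart)
      (auto simp: diag_mult_vec_component abs_mult intro!: mult_right_mono
        order_trans[OF assms abs_ge_self])
  \<comment> \<open>The index type is inhabited, so \<open>c\<close> dominates some absolute value;
    this removes the absolute value from \<open>norm (c *\<^sub>R x)\<close>.\<close>
  moreover have "c \<ge> 0"
    using assms abs_ge_zero order_trans by blast
  ultimately show ?thesis by simp
qed

text \<open>From above, \<open>U\<close> preserves norms, \<open>transpose W\<close> does not
  increase them, and the diagonal stretches by at most \<open>c\<close>. The bound is attained at
  column \<open>i\<close> of \<open>W\<close>, where the diagonal value has modulus
  \<open>c\<close>.\<close>

lemma spectral_norm_sandwich:
  assumes U: "orthonormal_columns U" and W: "orthonormal_columns W"
    and le: "\<And>i. \<bar>d i\<bar> \<le> c" and eq: "\<bar>d i\<bar> = c"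
  shows "spectral_norm (U ** diag d ** transpose W) = c"
proof (rule antisym)
  let ?A = "U ** diag d ** transpose W"
  have c: "c \<ge> 0" using eq by auto
  show "spectral_norm ?A \<le> c"
    unfolding spectral_norm_def
  proof (rule onorm_le)
    fix x
    have "norm (?A *v x) = norm (diag d *v (transpose W *v x))"
      by (metis matrix_vector_mul_assoc norm_orthonormal_columns_mult[OF U])
    also have "\<dots> \<le> c * norm (transpose W *v x)"
      by (rule norm_diag_mult_le[OF le])
    also have "\<dots> \<le> c * norm x"
      by (rule mult_left_mono[OF norm_transpose_orthonormal_columns_mult_le[OF W] c])
    finally show "norm (?A *v x) \<le> c * norm x" .
  qed
  \<comment> \<open>\<open>W *v ?e\<close> is a unit vector that \<open>transpose W\<close> sends
    back to \<open>?e\<close>, an eigenvector of \<open>diag d\<close> with eigenvalue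
    \<open>d i\<close>.\<close>
  let ?e = "axis i 1 :: real^_"
  have "?A *v (W *v ?e) = U *v (diag d *v ?e)"
    by (simp add: matrix_vector_mul_assoc matrix_mul_assoc[symmetric]
        orthonormal_columns_transpose_mult[OF W])
  moreover have "diag d *v ?e = d i *\<^sub>R ?e"
    by (simp add: vec_eq_iff diag_mult_vec_component axis_def)
  ultimately have "norm (?A *v (W *v ?e)) = c"
    using eq norm_orthonormal_columns_mult[OF U] by simp
  moreover have "norm (W *v ?e) = 1"
    using norm_orthonormal_columns_mult[OF W] by simp
  ultimately show "c \<le> spectral_norm ?A"
    using onorm[OF matrix_vector_mul_bounded_linear[of ?A], of "W *v ?e"]
    by (simp add: spectral_norm_def)
qed

section \<open>Closed form of the iterates\<close>

lemma newton_schulz_sandwich: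
  assumes U: "orthonormal_columns U" and V: "orthonormal_columns V"
    and \<sigma>: "\<And>i. \<sigma> i \<noteq> 0"
    and M: "M = U ** diag \<sigma> ** transpose V"
    and X_0: "X 0 = \<alpha> *\<^sub>R transpose M"
    and X_Suc: "\<And>k. X (Suc k) = X k ** (2 *\<^sub>R mat 1 - M ** X k)"
  shows "X k = V ** diag (\<lambda>i. (1 - (1 - \<alpha> * (\<sigma> i)\<^sup>2) ^ (2 ^ k)) / \<sigma> i) ** transpose U"
proof (induction k)
  case 0
  have "(\<lambda>i. (1 - (1 - \<alpha> * (\<sigma> i)\<^sup>2) ^ (2 ^ 0)) / \<sigma> i) = (\<lambda>i. \<alpha> * \<sigma> i)"
    using \<sigma> by (simp add: power2_eq_square)
  then show ?case
    by (simp only: X_0 M transpose_sandwich sandwich_scaleR)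
next
  case (Suc k)
  define x where "x i = (1 - (1 - \<alpha> * (\<sigma> i)\<^sup>2) ^ (2 ^ k)) / \<sigma> i" for i
  \<comment> \<open>Completing the square: \<open>\<sigma> * (2 * x - x * (\<sigma> * x)) = 1 - (1 -
    \<sigma> * x)\<^sup>2\<close>. By the choice of \<open>x\<close>, the residual
    \<open>1 - \<sigma> i * x i\<close> is the power with exponent \<open>2 ^ k\<close>, and
    squaring doubles the exponent.\<close>
  have step: "2 * x i - x i * (\<sigma> i * x i) = (1 - (1 - \<alpha> * (\<sigma> i)\<^sup>2) ^ (2 ^ Suc k)) / \<sigma> i" for i
  proof -
    have "(1 - \<alpha> * (\<sigma> i)\<^sup>2) ^ (2 ^ Suc k) = (1 - \<sigma> i * x i)\<^sup>2"
      using \<sigma>[of i] by (simp add: x_def power_mult[symmetric] mult.commute)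
    then show ?thesis
      using \<sigma>[of i] by (simp add: power2_eq_square field_simps)
  qed
  have IH: "X k = V ** diag x ** transpose U"
    using Suc by (simp add: x_def[abs_def])
  have "X (Suc k) = 2 *\<^sub>R X k - X k ** (M ** X k)"
    by (simp add: X_Suc matrix_diff_ldistrib matrix_scalar_ac flip: scalar_matrix_assoc)
  also have "\<dots> = V ** diag (\<lambda>i. 2 * x i - x i * (\<sigma> i * x i)) ** transpose U"
    by (simp add: IH M sandwich_mult U V sandwich_scaleR sandwich_diff)
  finally show ?case by (simp only: step)
qed

theorem theorem4p1:
  fixes M :: "real^'q^'p"
    and U :: "real^('r::{finite,linorder})^'p"
    and V :: "real^('r::{finite,linorder})^'q"
    and \<sigma> :: "'r::{finite,linorder} \<Rightarrow> real"
    and \<alpha> :: real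
    and X :: "nat \<Rightarrow> real^'p^'q"
  assumes X_0: "X 0 = \<alpha> *\<^sub>R transpose M"
    and X_Suc: "\<And>k. X (Suc k) = X k ** (2 *\<^sub>R mat 1 - M ** X k)"
  shows
    "(M \<noteq> 0 \<and> rank M = CARD('r) \<and> thin_svd M U \<sigma> V \<longrightarrow>
       (let \<theta> = (\<lambda>i. 1 - \<alpha> * (\<sigma> i)\<^sup>2);
            \<rho> = Max (range (\<lambda>i. \<bar>1 - \<alpha> * (\<sigma> i)\<^sup>2\<bar>));
            P\<^sub>L = M ** pinv M;
            P\<^sub>R = pinv M ** M
        in
          (0 < \<alpha> \<and> \<alpha> < 2 / (\<sigma> (Min UNIV))\<^sup>2 \<longrightarrow> X \<longlonglongrightarrow> pinv M \<and> \<rho> < 1) \<and>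
          (\<forall>k. X k = V ** diag (\<lambda>i. (1 - \<theta> i ^ (2 ^ k)) / \<sigma> i) ** transpose U) \<and>
          P\<^sub>L = U ** transpose U \<and>
          P\<^sub>R = V ** transpose V \<and>
          (\<forall>k. P\<^sub>L - M ** X k = U ** diag (\<lambda>i. \<theta> i ^ (2 ^ k)) ** transpose U) \<and>
          (\<forall>k. P\<^sub>R - X k ** M = V ** diag (\<lambda>i. \<theta> i ^ (2 ^ k)) ** transpose V) \<and>
          (\<rho> < 1 \<longrightarrow>
            (\<forall>k. spectral_norm (P\<^sub>L - M ** X k) = \<rho> ^ (2 ^ k) \<and>
                 spectral_norm (P\<^sub>R - X k ** M) = \<rho> ^ (2 ^ k))))) \<and>
     (M = 0 \<longrightarrow> pinv M = 0 \<and> (\<forall>k. X k = 0))"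
proof (intro conjI impI)
  assume "M \<noteq> 0 \<and> rank M = CARD('r) \<and> thin_svd M U \<sigma> V"
  then have U: "orthonormal_columns U" and V: "orthonormal_columns V"
    and pos: "\<And>i. \<sigma> i > 0" and mono: "\<And>i j. i \<le> j \<Longrightarrow> \<sigma> j \<le> \<sigma> i"
    and M: "M = U ** diag \<sigma> ** transpose V"
    by (auto simp: thin_svd_def)
  have nz: "\<sigma> i \<noteq> 0" for i
    using pos[of i] by simp
  define \<theta> where "\<theta> = (\<lambda>i. 1 - \<alpha> * (\<sigma> i)\<^sup>2)"
  define \<rho> where "\<rho> = Max (range (\<lambda>i. \<bar>1 - \<alpha> * (\<sigma> i)\<^sup>2\<bar>))"
  have \<rho>: "\<rho> = Max (range (\<lambda>i. \<bar>\<theta> i\<bar>))"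
    by (simp add: \<rho>_def \<theta>_def)
  have le: "\<bar>\<theta> i\<bar> \<le> \<rho>" for i
    unfolding \<rho> by (rule Max_ge) auto
  have "\<rho> \<in> range (\<lambda>i. \<bar>\<theta> i\<bar>)"
    unfolding \<rho> by (rule Max_in) auto
  \<comment> \<open>The index \<open>m\<close> attains the maximum; it later witnesses that the norm
    bound is sharp.\<close>
  then obtain m where m: "\<bar>\<theta> m\<bar> = \<rho>" by auto
  have X: "X k = V ** diag (\<lambda>i. (1 - \<theta> i ^ (2 ^ k)) / \<sigma> i) ** transpose U" for k
    using newton_schulz_sandwich[OF U V nz M X_0 X_Suc] by (simp add: \<theta>_def)
  have pinv: "pinv M = V ** diag (\<lambda>i. 1 / \<sigma> i) ** transpose U"
    unfolding M by (rule pinv_sandwich[OF U V nz])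
  \<comment> \<open>The projectors keep an explicit unit diagonal so that subtracting
    \<open>M ** X k\<close> or \<open>X k ** M\<close> acts on diagonals;
    \<open>sandwich_one\<close> removes it at the end.\<close>
  have PL: "M ** pinv M = U ** diag (\<lambda>_. 1) ** transpose U"
    by (simp add: M pinv_sandwich sandwich_mult U V nz)
  have PR: "pinv M ** M = V ** diag (\<lambda>_. 1) ** transpose V"
    by (simp add: M pinv_sandwich sandwich_mult U V nz)
  have RL: "M ** pinv M - M ** X k = U ** diag (\<lambda>i. \<theta> i ^ (2 ^ k)) ** transpose U" for k
    unfolding PL by (simp add: X M sandwich_mult V nz sandwich_diff)
  have RR: "pinv M ** M - X k ** M = V ** diag (\<lambda>i. \<theta> i ^ (2 ^ k)) ** transpose V" for k
    unfolding PR by (simp add: X M sandwich_mult U nz sandwich_diff)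
  have pow_le: "\<bar>\<theta> i ^ n\<bar> \<le> \<rho> ^ n" and pow_eq: "\<bar>\<theta> m ^ n\<bar> = \<rho> ^ n" for i n
    using le[of i] m by (simp_all add: power_abs power_mono)
  have conv: "X \<longlonglongrightarrow> pinv M \<and> \<rho> < 1" if \<alpha>: "0 < \<alpha> \<and> \<alpha> < 2 / (\<sigma> (Min UNIV))\<^sup>2"
  proof -
    \<comment> \<open>By \<open>mono\<close>, \<open>\<sigma> (Min UNIV)\<close> is the largest
      singular value, so the bound on \<alpha> gives
      \<open>0 < \<alpha> * (\<sigma> i)\<^sup>2 < 2\<close> for every \<open>i\<close>.\<close>
    have \<theta>_less: "\<bar>\<theta> i\<bar> < 1" for i
    proof -
      have "(\<sigma> i)\<^sup>2 \<le> (\<sigma> (Min UNIV))\<^sup>2"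
        using pos[of i] by (intro power_mono mono) (auto simp: less_imp_le)
      then have "\<alpha> * (\<sigma> i)\<^sup>2 \<le> \<alpha> * (\<sigma> (Min UNIV))\<^sup>2"
        using \<alpha> by (intro mult_left_mono) auto
      also have "\<dots> < 2"
        using \<alpha> pos[of "Min UNIV"] by (simp add: field_simps)
      finally have "\<alpha> * (\<sigma> i)\<^sup>2 < 2" .
      moreover have "\<alpha> * (\<sigma> i)\<^sup>2 > 0"
        using \<alpha> pos[of i] by simp
      ultimately show ?thesis by (simp add: \<theta>_def)
    qed
    \<comment> \<open>This is the subsequence of the geometric sequence along the strictly
      increasing exponents \<open>2 ^ k\<close>.\<close>
    have "(\<lambda>k. \<theta> i ^ (2 ^ k)) \<longlonglongrightarrow> 0" for i
      using LIMSEQ_subseq_LIMSEQ[OF LIMSEQ_power_zero[of "\<theta> i"], of "\<lambda>k. 2 ^ k"] \<theta>_less[of i]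
      by (simp add: comp_def strict_mono_def)
    then have "(\<lambda>k. (1 - \<theta> i ^ (2 ^ k)) / \<sigma> i) \<longlonglongrightarrow> (1 - 0) / \<sigma> i" for i
      using nz[of i] by (intro tendsto_intros)
    then have "X \<longlonglongrightarrow> V ** diag (\<lambda>i. (1 - 0) / \<sigma> i) ** transpose U"
      unfolding X[abs_def] by (rule tendsto_sandwich_diag)
    then show ?thesis
      using \<theta>_less[of m] m by (simp add: pinv)
  qed
  have normL: "spectral_norm (M ** pinv M - M ** X k) = \<rho> ^ (2 ^ k)" for k
    unfolding RL by (intro spectral_norm_sandwich U pow_le) (rule pow_eq)
  have normR: "spectral_norm (pinv M ** M - X k ** M) = \<rho> ^ (2 ^ k)" for k
    unfolding RR by (intro spectral_norm_sandwich V pow_le) (rule pow_eq)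
  show "let \<theta> = (\<lambda>i. 1 - \<alpha> * (\<sigma> i)\<^sup>2);
            \<rho> = Max (range (\<lambda>i. \<bar>1 - \<alpha> * (\<sigma> i)\<^sup>2\<bar>));
            P\<^sub>L = M ** pinv M;
            P\<^sub>R = pinv M ** M
        in
          (0 < \<alpha> \<and> \<alpha> < 2 / (\<sigma> (Min UNIV))\<^sup>2 \<longrightarrow> X \<longlonglongrightarrow> pinv M \<and> \<rho> < 1) \<and>
          (\<forall>k. X k = V ** diag (\<lambda>i. (1 - \<theta> i ^ (2 ^ k)) / \<sigma> i) ** transpose U) \<and>
          P\<^sub>L = U ** transpose U \<and>
          P\<^sub>R = V ** transpose V \<and>
          (\<forall>k. P\<^sub>L - M ** X k = U ** diag (\<lambda>i. \<theta> i ^ (2 ^ k)) ** transpose U) \<and>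
          (\<forall>k. P\<^sub>R - X k ** M = V ** diag (\<lambda>i. \<theta> i ^ (2 ^ k)) ** transpose V) \<and>
          (\<rho> < 1 \<longrightarrow>
            (\<forall>k. spectral_norm (P\<^sub>L - M ** X k) = \<rho> ^ (2 ^ k) \<and>
                 spectral_norm (P\<^sub>R - X k ** M) = \<rho> ^ (2 ^ k)))"
    unfolding Let_def \<theta>_def[symmetric] \<rho>_def[symmetric]
    using conv X PL PR RL RR normL normR by (simp only: sandwich_one) blast
next
  assume M: "M = 0"
  then show "pinv M = 0" by (simp add: pinv_zero)
  \<comment> \<open>The start is a multiple of \<open>transpose 0\<close>, and every step has
    \<open>X k\<close> as its left factor, so zero persists.\<close>
  have "X k = 0" for k
    by (induction k) (simp_all add: X_0 X_Suc M transpose_def vec_eq_iff matrix_matrix_mult_def)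
  then show "\<forall>k. X k = 0" ..
qed

end
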